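(* Let $H=(V,E)$ be a strongly connected hypergraph whose maximum hyperedge size is $M$, and let $m\ge M$. Then the $m$-Uplifted $\mathcal{H}$-Eigenvector Centrality ($m$-UHEC) vector of $H$ exists and is unique (up to scaling by a positive constant).
   Context: A hypergraph $H=(V,E)$ has a finite node set $V$ with $|V|=n$ and a finite set $E$ of hyperedges, each a set (possibly a multiset) of nodes of $V$; the size $|e|$ of a hyperedge is its number of elements, counted with multiplicity. $H$ is unweighted and undirected. It is strongly connected if the graph on $V$ in which two nodes are adjacent whenever some hyperedge contains both is connected. Uplift. Let $\star\notin V$ be an auxiliary node. The uplift of $H$ to order $m\ge M$ is $\widetilde H=(\widetilde V,\widetilde E)$ with $\widetilde V=V\cup\{\star\}$ and $\widetilde E$ the collection of multisets of size $m$ obtained by adding $m-|e|$ copies of $\star$ to each $e\in E$. If every hyperedge of $H$ already has size $m$, no auxiliary node is added and $\widetilde H=H$. Uplifted tensor. $\widetilde T$ is the symmetric tensor of order $m$ indexed by $\widetilde V$ with entries $$\widetilde T_{i_1\dots i_m}=\begin{cases}1 & \text{if } \{i_1,\dots,i_m\}\in E,\\ \dfrac{m^\star\,(m-m^\star)!}{m!} & \text{if } \{i_1,\dots,i_m\}\notin E \text{ and } \{i_1,\dots,i_m\}\in\widetilde E,\\ 0&\text{otherwise,}\end{cases}$$ where $\{i_1,\dots,i_m\}$ is read as a multiset and $m^\star$ is the number of copies of $\star$ in it. HEC. For a nonnegative tensor $T$ of order $m$ and a vector $\mathbf c$, write $(T\mathbf c^{m-1})_{i_1}=\sum_{i_2,\dots,i_m}T_{i_1i_2\dots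 i_m}c_{i_2}\cdots c_{i_m}$. The $\mathcal H$-eigenvector centrality (HEC) of an $m$-uniform hypergraph with adjacency tensor $T$ is a vector $\mathbf c$ with all components positive such that $(T\mathbf c^{m-1})_i=\lambda c_i^{m-1}$ for all nodes $i$ and some $\lambda\in\mathbb R$. $m$-UHEC. The $m$-UHEC of $H$ consists of the $n$ components associated with the nodes in $V$ of the HEC of $\widetilde H$, computed with the tensor $\widetilde T$. *)

theory Defs
  imports Complex_Main "HOL-Library.Multiset"
begin

section \<open>Hypergraphs\<close>

text \<open>
  Hyperedges are multisets of nodes. They are required to be nonempty, the usual convention; with
  an empty hyperedge allowed, the uplift would contain a hyperedge consisting only of copies of the
  auxiliary node, and existence of the centrality fails (for instance for one node and the empty
  hyperedge alone).
\<close>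

definition hypergraph :: "'a set \<Rightarrow> 'a multiset set \<Rightarrow> bool" where
  "hypergraph V E \<longleftrightarrow>
     finite V \<and> finite E \<and> (\<forall>e\<in>E. e \<noteq> {#} \<and> set_mset e \<subseteq> V)"

definition node_adjacency :: "'a multiset set \<Rightarrow> 'a rel" where
  "node_adjacency E = {(u, v). \<exists>e\<in>E. u \<in># e \<and> v \<in># e}"

definition strongly_connected :: "'a set \<Rightarrow> 'a multiset set \<Rightarrow> bool" where
  "strongly_connected V E \<longleftrightarrow>
     V \<noteq> {} \<and> (\<forall>u\<in>V. \<forall>v\<in>V. (u, v) \<in> (node_adjacency E)\<^sup>*)"


section \<open>Uplift\<close>

text \<open>
  The auxiliary node \<open>\<star>\<close> is \<^const>\<open>None\<close>, and a node \<open>v\<close> of the original hypergraph becomes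
  \<^term>\<open>Some v\<close>. If all hyperedges have size \<open>m\<close>, then no auxiliary node is added and the uplift
  is the original hypergraph, up to the embedding \<^const>\<open>Some\<close>.
\<close>

definition uplift_nodes :: "'a set \<Rightarrow> 'a multiset set \<Rightarrow> nat \<Rightarrow> 'a option set" where
  "uplift_nodes V E m =
     (if \<forall>e\<in>E. size e = m then Some ` V else insert None (Some ` V))"

definition uplift_edge :: "nat \<Rightarrow> 'a multiset \<Rightarrow> 'a option multiset" where
  "uplift_edge m e = image_mset Some e + replicate_mset (m - size e) None"

definition uplift_edges :: "'a multiset set \<Rightarrow> nat \<Rightarrow> 'a option multiset set" where
  "uplift_edges E m = uplift_edge m ` E"

text \<open>
  A tensor of order \<open>m\<close> is a function on index lists; only its values on lists of length \<open>m\<close> over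
  the index set are relevant.
\<close>

definition uplifted_tensor :: "'a multiset set \<Rightarrow> nat \<Rightarrow> 'a option list \<Rightarrow> real" where
  "uplifted_tensor E m is =
     (let k = count (mset is) None in
      if mset is \<in> image_mset Some ` E then 1
      else if mset is \<in> uplift_edges E m then real k * fact (m - k) / fact m
      else 0)"


section \<open>Eigenvector centralities\<close>

definition tensor_apply ::
    "'b set \<Rightarrow> nat \<Rightarrow> ('b list \<Rightarrow> real) \<Rightarrow> ('b \<Rightarrow> real) \<Rightarrow> 'b \<Rightarrow> real" where
  "tensor_apply W m T c i =
     (\<Sum>js | set js \<subseteq> W \<and> length js = m - 1. T (i # js) * (\<Prod>j\<leftarrow>js. c j))"

text \<open>Vectors indexed by a set are functions, of which only the values on that set matter.\<close>

definition is_HEC ::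
    "'b set \<Rightarrow> nat \<Rightarrow> ('b list \<Rightarrow> real) \<Rightarrow> ('b \<Rightarrow> real) \<Rightarrow> bool" where
  "is_HEC W m T c \<longleftrightarrow>
     (\<forall>i\<in>W. c i > 0) \<and>
     (\<exists>l::real. \<forall>i\<in>W. tensor_apply W m T c i = l * c i ^ (m - 1))"

definition is_UHEC ::
    "'a set \<Rightarrow> 'a multiset set \<Rightarrow> nat \<Rightarrow> ('a \<Rightarrow> real) \<Rightarrow> bool" where
  "is_UHEC V E m c \<longleftrightarrow>
     (\<exists>c'. is_HEC (uplift_nodes V E m) m (uplifted_tensor E m) c' \<and>
           (\<forall>v\<in>V. c v = c' (Some v)))"

end

theory Submission
  imports Defs "HOL-Analysis.Function_Topology"
begin

text \<open>
  Perron--Frobenius for a symmetric, nonnegative, irreducible tensor. Existence: maximise the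
  form \<open>F\<close> of \<open>T\<close> over nonnegative \<open>x\<close> with \<open>\<Sum>i. x i ^ m = 1\<close>. Raising the zero entries of
  a maximiser to \<open>\<epsilon>\<close> would, by irreducibility, raise \<open>F\<close> by at least a multiple of \<open>\<epsilon> ^ (m - 1)\<close>,
  but \<open>\<Sum>i. x i ^ m\<close> only by a multiple of \<open>\<epsilon> ^ m\<close>; so the maximiser is
  positive, and by symmetry of \<open>T\<close> its Lagrange condition is the eigenvector equation. Uniqueness:
  for positive eigenvectors \<open>c\<close>, \<open>c'\<close>, comparing them where \<open>c'/c\<close> is maximal shows
  that the eigenvalues agree and that the set of maximisers of \<open>c'/c\<close> is closed under adjacency.
\<close>

section \<open>Symmetric irreducible tensors\<close>

lemma prod_list_map_nonneg:
  fixes f :: "'b \<Rightarrow> real"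
  assumes "\<And>x. x \<in> set xs \<Longrightarrow> 0 \<le> f x"
  shows "0 \<le> prod_list (map f xs)"
  using assms by (induction xs) auto

lemma prod_list_map_pos:
  fixes f :: "'b \<Rightarrow> real"
  assumes "\<And>x. x \<in> set xs \<Longrightarrow> 0 < f x"
  shows "0 < prod_list (map f xs)"
  using assms by (induction xs) auto

lemma prod_list_map_mono:
  fixes f g :: "'b \<Rightarrow> real"
  assumes "\<And>x. x \<in> set xs \<Longrightarrow> 0 \<le> f x \<and> f x \<le> g x"
  shows "prod_list (map f xs) \<le> prod_list (map g xs)"
  using assms
proof (induction xs)
  case (Cons a xs)
  then show ?case
    using prod_list_map_nonneg[of xs f] by (auto intro!: mult_mono intro: order_trans)
qed auto

lemma prod_list_map_strict_mono:
  fixes f g :: "'b \<Rightarrow> real"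
  assumes "\<And>x. x \<in> set xs \<Longrightarrow> 0 < f x \<and> f x \<le> g x"
    and "y \<in> set xs" "f y < g y"
  shows "prod_list (map f xs) < prod_list (map g xs)"
  using assms
proof (induction xs)
  case (Cons a xs)
  have pos: "0 < prod_list (map f xs)" "0 < g a"
    using Cons.prems(1) by (auto intro!: prod_list_map_pos intro: less_le_trans)
  have le: "prod_list (map f xs) \<le> prod_list (map g xs)"
    using Cons.prems(1) by (intro prod_list_map_mono) (simp add: less_imp_le)
  show ?case
  proof (cases "f a < g a")
    case True
    then have "f a * prod_list (map f xs) < g a * prod_list (map f xs)"
      using pos by simp
    also have "\<dots> \<le> g a * prod_list (map g xs)"
      using le pos by simp
    finally show ?thesis by simp
  next
    case False
    then have "prod_list (map f xs) < prod_list (map g xs)"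
      using Cons by (metis list.set_intros(2) set_ConsD)
    moreover have "f a = g a"
      using False Cons.prems(1)[of a] by simp
    ultimately show ?thesis
      using pos by simp
  qed
qed auto

lemma prod_list_map_scale:
  fixes f :: "'b \<Rightarrow> real"
  shows "prod_list (map (\<lambda>x. a * f x) xs) = a ^ length xs * prod_list (map f xs)"
  by (induction xs) (auto simp: algebra_simps)

lemma prod_list_map_upd_scale:
  fixes f :: "'b \<Rightarrow> real"
  shows "prod_list (map (f(i := t * f i)) xs) = t ^ count_list xs i * prod_list (map f xs)"
  by (induction xs) (auto simp: algebra_simps)

lemma count_list_eq_sum_nth:
  "count_list xs a = (\<Sum>k<length xs. of_bool (xs ! k = a))"
  by (induction xs) (auto simp: sum.lessThan_Suc_shift simp del: sum.lessThan_Suc)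

text \<open>This is Tychonoff's theorem, so \<open>'b\<close> may be infinite. Pinning the
  coordinates outside \<open>W\<close> to 0 loses nothing: \<open>form\<close> and the power sum
  only read coordinates in \<open>W\<close>.\<close>

lemma compact_cube_zero_outside:
  "compact {x :: 'b \<Rightarrow> real. \<forall>i. x i \<in> (if i \<in> W then {0..1} else {0})}"
proof -
  have "{x :: 'b \<Rightarrow> real. \<forall>i. x i \<in> (if i \<in> W then {0..1} else {0})}
      = PiE UNIV (\<lambda>i. if i \<in> W then {0..1} else {0})"
    by (auto simp: PiE_def Pi_def extensional_def)
  moreover have "compactin (product_topology (\<lambda>_. euclidean :: real topology) UNIV)
      (PiE UNIV (\<lambda>i :: 'b. if i \<in> W then {0..1} else {0}))"
    by (simp add: compactin_PiE)
  ultimately show ?thesis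
    by (simp add: euclidean_product_topology)
qed

text \<open>Irreducibility is the weak notion: draw an arc from \<open>i\<close> to every entry of
  \<open>js\<close> whenever \<open>T (i # js)\<close> is positive; then every nonempty proper
  subset of \<open>W\<close> has an outgoing arc, that is, the digraph on \<open>W\<close> is
  strongly connected.\<close>

locale irreducible_tensor =
  fixes W :: "'b set" and m :: nat and T :: "'b list \<Rightarrow> real"
  assumes finite_W: "finite W" and nonempty_W: "W \<noteq> {}" and m_pos: "0 < m"
    and nonneg: "0 \<le> T is"
    and symmetric: "mset is = mset js \<Longrightarrow> T is = T js"
    and irreducible: "S \<subset> W \<Longrightarrow> S \<noteq> {} \<Longrightarrow>
      \<exists>i\<in>S. \<exists>js. set js \<subseteq> W \<and> length js = m - 1 \<and> \<not> set js \<subseteq> S \<and> 0 < T (i # js)"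
begin

section \<open>Uniqueness: comparison of positive eigenvectors\<close>

lemma tensor_apply_mono:
  assumes "\<And>j. j \<in> W \<Longrightarrow> 0 \<le> c j \<and> c j \<le> d j"
  shows "tensor_apply W m T c i \<le> tensor_apply W m T d i"
  unfolding tensor_apply_def
  using assms nonneg by (intro sum_mono mult_left_mono prod_list_map_mono) auto

lemma tensor_apply_scale:
  "tensor_apply W m T (\<lambda>j. a * c j) i = a ^ (m - 1) * tensor_apply W m T c i"
  unfolding tensor_apply_def sum_distrib_left prod_list_map_scale
  by (intro sum.cong) auto

text \<open>The term of \<open>js\<close> grows strictly, since its factors are positive and the one
  at \<open>j\<close> increases; no other term decreases.\<close>

lemma tensor_apply_strict_mono:
  assumes "\<And>j. j \<in> W \<Longrightarrow> 0 < c j \<and> c j \<le> d j"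
    and "set js \<subseteq> W" "length js = m - 1" "0 < T (i # js)"
    and "j \<in> set js" "c j < d j"
  shows "tensor_apply W m T c i < tensor_apply W m T d i"
  unfolding tensor_apply_def
proof (rule sum_strict_mono_ex1)
  show "finite {js. set js \<subseteq> W \<and> length js = m - 1}"
    using finite_W by (rule finite_lists_length_eq)
  show "\<forall>js\<in>{js. set js \<subseteq> W \<and> length js = m - 1}.
      T (i # js) * prod_list (map c js) \<le> T (i # js) * prod_list (map d js)"
    using assms(1) nonneg
    by (intro ballI mult_left_mono prod_list_map_mono) (auto simp: less_imp_le)
  have "prod_list (map c js) < prod_list (map d js)"
    using assms by (intro prod_list_map_strict_mono[of _ _ _ j]) auto
  then show "\<exists>js\<in>{js. set js \<subseteq> W \<and> length js = m - 1}.
      T (i # js) * prod_list (map c js) < T (i # js) * prod_list (map d js)"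
    using assms by (intro bexI[of _ js]) auto
qed

text \<open>The least \<open>s\<close> for which \<open>s * c\<close> dominates \<open>d\<close>:
  the two vectors touch at \<open>i\<close>, and that is where the eigenvector equations get
  compared.\<close>

lemma max_ratio:
  assumes "\<And>i. i \<in> W \<Longrightarrow> 0 < c i" "\<And>i. i \<in> W \<Longrightarrow> (0::real) < d i"
  obtains s i where "0 < s" "i \<in> W" "d i = s * c i" "\<And>j. j \<in> W \<Longrightarrow> d j \<le> s * c j"
proof -
  define s where "s = Max ((\<lambda>i. d i / c i) ` W)"
  have "s \<in> (\<lambda>i. d i / c i) ` W"
    unfolding s_def using finite_W nonempty_W by (intro Max_in) auto
  then obtain i where i: "i \<in> W" "s = d i / c i"
    by auto
  have "d j \<le> s * c j" if "j \<in> W" for j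
  proof -
    have "d j / c j \<le> s"
      unfolding s_def using finite_W that by (intro Max_ge) auto
    then show ?thesis
      using assms(1)[OF that] by (simp add: field_simps)
  qed
  moreover have "d i = s * c i" "0 < s"
    using i assms(1,2)[OF i(1)] by auto
  ultimately show ?thesis
    using i that by blast
qed

text \<open>At the touching node, monotonicity gives
  \<open>k * d i ^ (m - 1) \<le> l * (s * c i) ^ (m - 1)\<close>, and the powers cancel because
  \<open>s * c i = d i\<close>.\<close>

lemma eigenvalue_le:
  assumes c: "\<And>i. i \<in> W \<Longrightarrow> 0 < c i" "\<And>i. i \<in> W \<Longrightarrow> tensor_apply W m T c i = l * c i ^ (m - 1)"
    and d: "\<And>i. i \<in> W \<Longrightarrow> 0 < d i" "\<And>i. i \<in> W \<Longrightarrow> tensor_apply W m T d i = k * d i ^ (m - 1)"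
  shows "k \<le> l"
proof -
  obtain s i where s: "0 < s" "i \<in> W" "d i = s * c i" "\<And>j. j \<in> W \<Longrightarrow> d j \<le> s * c j"
    using max_ratio[of c d] c(1) d(1) by blast
  have "k * d i ^ (m - 1) = tensor_apply W m T d i"
    using d(2) s(2) by simp
  also have "\<dots> \<le> tensor_apply W m T (\<lambda>j. s * c j) i"
    using s d(1) by (intro tensor_apply_mono) (simp add: less_imp_le)
  also have "\<dots> = l * d i ^ (m - 1)"
    using s c(2)[OF s(2)] by (simp add: tensor_apply_scale power_mult_distrib)
  finally show ?thesis
    using d(1)[OF s(2)] by simp
qed

theorem HEC_unique:
  assumes "is_HEC W m T c" "is_HEC W m T d"
  shows "\<exists>a>0. \<forall>i\<in>W. d i = a * c i"
proof -
  obtain l where c: "\<And>i. i \<in> W \<Longrightarrow> 0 < c i"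
      "\<And>i. i \<in> W \<Longrightarrow> tensor_apply W m T c i = l * c i ^ (m - 1)"
    using assms(1) unfolding is_HEC_def by blast
  obtain k where d: "\<And>i. i \<in> W \<Longrightarrow> 0 < d i"
      "\<And>i. i \<in> W \<Longrightarrow> tensor_apply W m T d i = k * d i ^ (m - 1)"
    using assms(2) unfolding is_HEC_def by blast
  have "k = l"
    using eigenvalue_le[OF c d] eigenvalue_le[OF d c] by simp
  obtain s i where s: "0 < s" "i \<in> W" "d i = s * c i" "\<And>j. j \<in> W \<Longrightarrow> d j \<le> s * c j"
    using max_ratio[of c d] c(1) d(1) by blast
  \<comment> \<open>The touching nodes. If they were not all of \<open>W\<close>, some
    \<open>p\<close> in \<open>S\<close> would have a neighbour \<open>q\<close> with
    \<open>d q < s * c q\<close>; the tensor would then separate \<open>d\<close> from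
    \<open>s * c\<close> strictly at \<open>p\<close>, where equal eigenvalues force
    equality.\<close>
  define S where "S = {j \<in> W. d j = s * c j}"
  have "S = W"
  proof (rule ccontr)
    assume "S \<noteq> W"
    then have "S \<subset> W" "S \<noteq> {}"
      using s by (auto simp: S_def)
    then obtain p js where p: "p \<in> S" "set js \<subseteq> W" "length js = m - 1" "\<not> set js \<subseteq> S" "0 < T (p # js)"
      using irreducible[of S] by blast
    then obtain q where q: "q \<in> set js" "q \<in> W" "d q < s * c q"
      using s(4) by (force simp: S_def)
    have pW: "p \<in> W" and dp: "d p = s * c p"
      using p(1) by (auto simp: S_def)
    have "k * d p ^ (m - 1) = tensor_apply W m T d p"
      using d(2) pW by simp
    also have "\<dots> < tensor_apply W m T (\<lambda>j. s * c j) p"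
      using s d(1) p q by (intro tensor_apply_strict_mono[of _ _ js _ q]) auto
    also have "\<dots> = l * d p ^ (m - 1)"
      using dp c(2)[OF pW] by (simp add: tensor_apply_scale power_mult_distrib)
    finally show False
      using \<open>k = l\<close> by simp
  qed
  then show ?thesis
    using s(1) by (auto simp: S_def)
qed

section \<open>Existence: constrained maximum of the form of \<open>T\<close>\<close>

definition form :: "('b \<Rightarrow> real) \<Rightarrow> real" where
  "form x = (\<Sum>is | set is \<subseteq> W \<and> length is = m. T is * prod_list (map x is))"

lemma form_nonneg:
  assumes "\<And>i. i \<in> W \<Longrightarrow> 0 \<le> x i"
  shows "0 \<le> form x"
  unfolding form_def
  using assms nonneg by (intro sum_nonneg mult_nonneg_nonneg prod_list_map_nonneg) auto

lemma form_scale: "form (\<lambda>i. a * x i) = a ^ m * form x"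
  unfolding form_def sum_distrib_left prod_list_map_scale
  by (intro sum.cong) auto

lemma form_cong: "(\<And>i. i \<in> W \<Longrightarrow> x i = y i) \<Longrightarrow> form x = form y"
  unfolding form_def
  by (intro sum.cong refl arg_cong2[of _ _ _ _ "(*)"] arg_cong[of _ _ prod_list] map_cong) auto

lemma continuous_on_form: "continuous_on A form"
proof -
  have "continuous_on A (\<lambda>x :: 'b \<Rightarrow> real. prod_list (map x is))" for "is"
    by (induction "is") (auto intro!: continuous_on_mult intro: continuous_on_subset[OF continuous_on_product_coordinates])
  then show ?thesis
    unfolding form_def[abs_def] by (intro continuous_intros)
qed

text \<open>Symmetry enters the existence proof only here.\<close>

lemma sum_count_eq_tensor_apply:
  assumes "i \<in> W"
  shows "(\<Sum>is | set is \<subseteq> W \<and> length is = m. T is * (real (count_list is i) * prod_list (map x is)))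
    = real m * (x i * tensor_apply W m T x i)"
proof -
  let ?A = "{is. set is \<subseteq> W \<and> length is = m}"
  let ?B = "{js. set js \<subseteq> W \<and> length js = m - 1}"
  have fin: "finite ?A"
    using finite_W by (rule finite_lists_length_eq)
  \<comment> \<open>Deleting slot \<open>k\<close> is a bijection from the lists with
    \<open>i\<close> in that slot to the lists of length \<open>m - 1\<close>; by symmetry
    \<open>i\<close> may be moved to the front without changing \<open>T\<close>.\<close>
  have slot: "(\<Sum>is\<in>?A. of_bool (is ! k = i) * (T is * prod_list (map x is)))
      = x i * tensor_apply W m T x i" if k: "k < m" for k
  proof -
    have "(\<Sum>is\<in>?A. of_bool (is ! k = i) * (T is * prod_list (map x is)))
        = (\<Sum>is\<in>{is\<in>?A. is ! k = i}. T is * prod_list (map x is))"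
      by (rule sum.mono_neutral_cong_right) (use fin in auto)
    also have "\<dots> = (\<Sum>js\<in>?B. T (i # js) * prod_list (map x (i # js)))"
    proof (rule sum.reindex_bij_witness
        [of _ "\<lambda>js. take k js @ i # drop k js" "\<lambda>is. take k is @ drop (Suc k) is"])
      fix "is" assume is_A: "is \<in> {is\<in>?A. is ! k = i}"
      then have len: "k < length is" and eq: "take k is @ i # drop (Suc k) is = is"
        using k id_take_nth_drop[of k "is"] by simp_all
      show "take k (take k is @ drop (Suc k) is) @ i # drop k (take k is @ drop (Suc k) is) = is"
        using eq len by simp
      show "take k is @ drop (Suc k) is \<in> ?B"
        using is_A k set_take_subset[of k "is"] set_drop_subset[of "Suc k" "is"] by auto
      have "mset is = mset (i # (take k is @ drop (Suc k) is))"
        by (subst eq[symmetric]) simp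
      then show "T (i # (take k is @ drop (Suc k) is)) * prod_list (map x (i # (take k is @ drop (Suc k) is)))
          = T is * prod_list (map x is)"
        using symmetric[of "is" "i # (take k is @ drop (Suc k) is)"]
        by (metis mset_map prod_mset_prod_list)
    next
      fix js assume js: "js \<in> ?B"
      then have len: "k \<le> length js"
        using k by auto
      then show "take k (take k js @ i # drop k js) @ drop (Suc k) (take k js @ i # drop k js) = js"
        by simp
      show "take k js @ i # drop k js \<in> {is\<in>?A. is ! k = i}"
        using js k len assms set_take_subset[of k js] set_drop_subset[of k js]
        by (auto simp: nth_append)
    qed
    also have "\<dots> = x i * tensor_apply W m T x i"
      by (simp add: tensor_apply_def sum_distrib_left algebra_simps)
    finally show ?thesis .
  qed
  \<comment> \<open>The multiplicity of \<open>i\<close> is the number of slots holding it, so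
    exchanging sums leaves \<open>m\<close> equal slot sums. The total is \<open>x i\<close> times
    the partial derivative of \<open>form\<close> in direction \<open>i\<close>.\<close>
  have "(\<Sum>is\<in>?A. T is * (real (count_list is i) * prod_list (map x is)))
      = (\<Sum>is\<in>?A. \<Sum>k<m. of_bool (is ! k = i) * (T is * prod_list (map x is)))"
    by (intro sum.cong refl) (simp add: count_list_eq_sum_nth flip: sum_distrib_right)
  also have "\<dots> = (\<Sum>k<m. \<Sum>is\<in>?A. of_bool (is ! k = i) * (T is * prod_list (map x is)))"
    by (rule sum.swap)
  also have "\<dots> = real m * (x i * tensor_apply W m T x i)"
    by (simp add: slot)
  finally show ?thesis .
qed

text \<open>Both \<open>form\<close> and the power sum are homogeneous of degree \<open>m\<close>,
  so the maximum on the unit sphere becomes an inequality without constraint, and later competitors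
  need no normalisation.\<close>

lemma form_maximiser:
  obtains x where "\<And>i. i \<in> W \<Longrightarrow> 0 \<le> x i" "(\<Sum>i\<in>W. x i ^ m) = 1"
    "\<And>y. (\<And>i. i \<in> W \<Longrightarrow> 0 \<le> y i) \<Longrightarrow> 0 < (\<Sum>i\<in>W. y i ^ m) \<Longrightarrow>
      form y \<le> form x * (\<Sum>i\<in>W. y i ^ m)"
proof -
  define K where "K = {x :: 'b \<Rightarrow> real. \<forall>i. x i \<in> (if i \<in> W then {0..1} else {0})}
    \<inter> {x. (\<Sum>i\<in>W. x i ^ m) = 1}"
  \<comment> \<open>The upper bound 1 of the cube is automatic: a nonnegative summand is at most the
    total, which is 1.\<close>
  have K_I: "z \<in> K"
    if z: "\<And>i. i \<in> W \<Longrightarrow> 0 \<le> z i" "\<And>i. i \<notin> W \<Longrightarrow> z i = 0" "(\<Sum>i\<in>W. z i ^ m) = 1" for z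
  proof -
    have "z i \<le> 1" if "i \<in> W" for i
    proof -
      have "z i ^ m \<le> (\<Sum>i\<in>W. z i ^ m)"
        using finite_W that z(1) by (intro member_le_sum) auto
      then show ?thesis
        using z that m_pos power_mono_iff[of "z i" 1 m] by simp
    qed
    then show ?thesis
      using z by (simp add: K_def)
  qed
  have "closed {x :: 'b \<Rightarrow> real. (\<Sum>i\<in>W. x i ^ m) = 1}"
    by (intro closed_Collect_eq continuous_intros continuous_on_product_coordinates)
  then have "compact K"
    unfolding K_def using compact_cube_zero_outside by (rule compact_Int_closed[rotated])
  moreover have "K \<noteq> {}"
  proof -
    obtain w where "w \<in> W"
      using nonempty_W by blast
    then have "(\<lambda>i. of_bool (i = w)) \<in> K"
      using finite_W m_pos by (intro K_I) (auto simp: of_bool_def if_distrib[of "\<lambda>t. t ^ m"] zero_power cong: if_cong)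
    then show ?thesis
      by blast
  qed
  ultimately have "\<exists>x\<in>K. \<forall>z\<in>K. form z \<le> form x"
    using continuous_on_form by (rule continuous_attains_sup)
  then obtain x where x: "x \<in> K" "\<And>z. z \<in> K \<Longrightarrow> form z \<le> form x"
    by blast
  show ?thesis
  proof
    show "0 \<le> x i" if "i \<in> W" for i
      using x(1) that unfolding K_def by (auto split: if_splits dest!: spec[of _ i])
    show "(\<Sum>i\<in>W. x i ^ m) = 1"
      using x(1) by (simp add: K_def)
    fix y :: "'b \<Rightarrow> real"
    assume y: "\<And>i. i \<in> W \<Longrightarrow> 0 \<le> y i" and N: "0 < (\<Sum>i\<in>W. y i ^ m)" (is "0 < ?N")
    \<comment> \<open>Scaling by \<open>r\<close> brings the power sum to 1; zeroing outside
      \<open>W\<close> then puts the vector into \<open>K\<close>.\<close>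
    define r where "r = inverse (root m ?N)"
    have r: "0 < r" "r ^ m = inverse ?N"
      using N m_pos by (simp_all add: r_def power_inverse)
    define z where "z = (\<lambda>i. if i \<in> W then r * y i else 0)"
    have "(\<Sum>i\<in>W. z i ^ m) = r ^ m * ?N"
      by (simp add: z_def power_mult_distrib sum_distrib_left)
    then have "z \<in> K"
      using r y N by (intro K_I) (auto simp: z_def)
    moreover have "form z = r ^ m * form y"
      unfolding form_scale[symmetric] by (rule form_cong) (simp add: z_def)
    ultimately show "form y \<le> form x * ?N"
      using mult_right_mono[OF x(2)[of z], of ?N] r N by (simp add: field_simps)
  qed
qed

lemma maximiser_pos:
  assumes x: "\<And>i. i \<in> W \<Longrightarrow> 0 \<le> x i" "(\<Sum>i\<in>W. x i ^ m) = 1"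
    and opt: "\<And>y. (\<And>i. i \<in> W \<Longrightarrow> 0 \<le> y i) \<Longrightarrow> 0 < (\<Sum>i\<in>W. y i ^ m) \<Longrightarrow>
      form y \<le> form x * (\<Sum>i\<in>W. y i ^ m)"
    and "i \<in> W"
  shows "0 < x i"
proof (rule ccontr)
  assume "\<not> 0 < x i"
  define S where "S = {j \<in> W. 0 < x j}"
  define Z where "Z = {j \<in> W. x j = 0}"
  have WSZ: "W = S \<union> Z" "S \<inter> Z = {}" "finite S" "finite Z"
    using x(1) finite_W by (force simp: S_def Z_def)+
  have "S \<subset> W"
    using \<open>\<not> 0 < x i\<close> \<open>i \<in> W\<close> by (auto simp: S_def)
  moreover have "S \<noteq> {}"
  proof
    assume "S = {}"
    then have "x j = 0" if "j \<in> W" for j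
      using WSZ that by (auto simp: Z_def)
    then show False
      using x(2) m_pos by (simp add: zero_power)
  qed
  ultimately obtain p js where p: "p \<in> S" "set js \<subseteq> W" "length js = m - 1" "\<not> set js \<subseteq> S" "0 < T (p # js)"
    using irreducible[of S] by blast
  \<comment> \<open>The term of \<open>p # js\<close> vanishes at \<open>x\<close>, as
    \<open>js\<close> meets \<open>Z\<close>. At \<open>y\<close> it is at least
    \<open>C * e ^ (m - 1)\<close>: the factor \<open>x p\<close> is kept because \<open>p\<close>
    is in \<open>S\<close>, and the other \<open>m - 1\<close> factors are at least
    \<open>e\<close>.\<close>
  define C where "C = T (p # js) * x p"
  have "0 < C"
    using p by (simp add: C_def S_def)
  \<comment> \<open>Raising the zero entries to \<open>e\<close> adds \<open>card Z * e ^ m\<close>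
    to the power sum, so optimality of \<open>x\<close> lets \<open>form\<close> grow by at most
    \<open>b * e ^ m\<close>.\<close>
  define b where "b = form x * real (card Z)"
  have "0 \<le> b"
    using form_nonneg[of x] x(1) by (simp add: b_def)
  \<comment> \<open>The first bound keeps \<open>e\<close> below every positive entry, so
    \<open>y\<close> is at least \<open>e\<close> on all of \<open>W\<close>. The second forces
    \<open>b * e < C\<close>; the summand 1 covers \<open>b = 0\<close>.\<close>
  define e where "e = min (Min (x ` S)) (C / (b + 1))"
  have "0 < Min (x ` S)"
    using WSZ(3) \<open>S \<noteq> {}\<close> by (subst Min_gr_iff) (auto simp: S_def)
  then have "0 < e"
    using \<open>0 < C\<close> \<open>0 \<le> b\<close> by (simp add: e_def)
  have e_le: "e \<le> x j" if "j \<in> S" for j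
    using WSZ(3) that by (simp add: e_def min_le_iff_disj)
  define y where "y = (\<lambda>j. if j \<in> Z then e else x j)"
  have y: "0 \<le> x j \<and> x j \<le> y j \<and> e \<le> y j" if "j \<in> W" for j
  proof (cases "j \<in> Z")
    case True
    then show ?thesis
      using \<open>0 < e\<close> by (simp add: y_def Z_def)
  next
    case False
    then have "j \<in> S"
      using WSZ(1) that by blast
    then show ?thesis
      using False x(1)[OF that] e_le by (simp add: y_def)
  qed
  have "(\<Sum>j\<in>W. y j ^ m) = (\<Sum>j\<in>S. y j ^ m) + (\<Sum>j\<in>Z. y j ^ m)"
    unfolding WSZ(1) using WSZ(2-4) by (intro sum.union_disjoint)
  also have "(\<Sum>j\<in>Z. y j ^ m) = card Z * e ^ m"
    by (simp add: y_def)
  also have "(\<Sum>j\<in>S. y j ^ m) = (\<Sum>j\<in>W. x j ^ m)"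
  proof (rule sum.mono_neutral_cong_left)
    show "\<forall>j\<in>W - S. x j ^ m = 0"
      using WSZ(1) m_pos by (auto simp: Z_def zero_power)
    show "y j ^ m = x j ^ m" if "j \<in> S" for j
      using that by (simp add: y_def S_def Z_def)
  qed (use finite_W WSZ(1) in auto)
  finally have norm_y: "(\<Sum>j\<in>W. y j ^ m) = 1 + card Z * e ^ m"
    using x(2) by simp
  let ?A = "{is. set is \<subseteq> W \<and> length is = m}"
  have finA: "finite ?A" and inA: "p # js \<in> ?A"
    using finite_W finite_lists_length_eq p m_pos by (auto simp: S_def)
  have "C * e ^ (m - 1) \<le> T (p # js) * prod_list (map y (p # js))"
  proof -
    have "e ^ (m - 1) = prod_list (map (\<lambda>_. e) js)"
      using p(3) by (simp add: map_replicate_const)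
    also have "\<dots> \<le> prod_list (map y js)"
      using y p(2) \<open>0 < e\<close> by (intro prod_list_map_mono) auto
    finally have "C * e ^ (m - 1) \<le> C * prod_list (map y js)"
      using \<open>0 < C\<close> by simp
    moreover have "y p = x p"
      using p(1) WSZ(2) by (auto simp: y_def)
    ultimately show ?thesis
      by (simp add: C_def algebra_simps)
  qed
  moreover have "prod_list (map x (p # js)) = 0"
  proof -
    obtain q where "q \<in> set js" "q \<in> Z"
      using p(2,4) WSZ(1) by blast
    then have "0 \<in> set (map x (p # js))"
      by (force simp: Z_def)
    then show ?thesis
      unfolding prod_list_zero_iff .
  qed
  ultimately have "C * e ^ (m - 1) \<le> T (p # js) * prod_list (map y (p # js)) - T (p # js) * prod_list (map x (p # js))"
    by (simp del: list.map)
  also have "\<dots> \<le> (\<Sum>is\<in>?A. T is * prod_list (map y is) - T is * prod_list (map x is))"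
  proof (rule member_le_sum[OF inA _ finA])
    fix "is" assume "is \<in> ?A - {p # js}"
    then have "prod_list (map x is) \<le> prod_list (map y is)"
      using y by (intro prod_list_map_mono) auto
    then show "0 \<le> T is * prod_list (map y is) - T is * prod_list (map x is)"
      using nonneg by (simp add: mult_left_mono)
  qed
  also have "\<dots> = form y - form x"
    by (simp add: form_def sum_subtractf)
  also have "form y \<le> form x * (1 + card Z * e ^ m)"
    unfolding norm_y[symmetric]
  proof (rule opt)
    show "0 \<le> y j" if "j \<in> W" for j
      using y[OF that] by linarith
    show "0 < (\<Sum>j\<in>W. y j ^ m)"
      unfolding norm_y using \<open>0 < e\<close> by (simp add: add_pos_nonneg)
  qed
  \<comment> \<open>Cancelling \<open>e ^ (m - 1)\<close> against the lower bound on the gain leaves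
    one spare factor \<open>e\<close> on this side.\<close>
  also have "form x * (1 + card Z * e ^ m) - form x = b * e * e ^ (m - 1)"
    using m_pos by (simp add: b_def power_eq_if algebra_simps)
  finally have "C \<le> b * e"
    using \<open>0 < e\<close> by simp
  also have "\<dots> \<le> b * (C / (b + 1))"
    using \<open>0 \<le> b\<close> by (intro mult_left_mono) (simp_all add: e_def)
  also have "\<dots> < C"
    using \<open>0 \<le> b\<close> \<open>0 < C\<close> by (simp add: field_simps)
  finally show False
    by simp
qed

theorem HEC_exists: "\<exists>c. is_HEC W m T c"
proof (rule form_maximiser)
  fix x assume x: "\<And>i. i \<in> W \<Longrightarrow> 0 \<le> x i" "(\<Sum>i\<in>W. x i ^ m) = 1"
    and opt: "\<And>y. (\<And>i. i \<in> W \<Longrightarrow> 0 \<le> y i) \<Longrightarrow> 0 < (\<Sum>i\<in>W. y i ^ m) \<Longrightarrow>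
      form y \<le> form x * (\<Sum>i\<in>W. y i ^ m)"
  have pos: "0 < x i" if "i \<in> W" for i
    using maximiser_pos[OF x opt that] by simp
  have "tensor_apply W m T x i = form x * x i ^ (m - 1)" if i: "i \<in> W" for i
  proof -
    let ?A = "{is. set is \<subseteq> W \<and> length is = m}"
    \<comment> \<open>Scaling only entry \<open>i\<close> by \<open>t\<close> multiplies each term
      by a power of \<open>t\<close>, so the optimality gap becomes a polynomial in one variable
      with maximum 0 at \<open>t = 1\<close>.\<close>
    define g where "g t = (\<Sum>is\<in>?A. T is * (t ^ count_list is i * prod_list (map x is)))
      - form x * (1 - x i ^ m + t ^ m * x i ^ m)" for t
    have g: "g t \<le> g 1" if "0 < t" for t
    proof -
      let ?y = "x(i := t * x i)"
      have "(\<Sum>j\<in>W. ?y j ^ m) = t ^ m * x i ^ m + (\<Sum>j\<in>W - {i}. x j ^ m)"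
        using finite_W i by (subst sum.remove[of _ i]) (auto simp: power_mult_distrib intro!: sum.cong)
      also have "\<dots> = 1 - x i ^ m + t ^ m * x i ^ m"
        using finite_W i x(2) by (simp add: sum_diff1)
      finally have norm: "(\<Sum>j\<in>W. ?y j ^ m) = 1 - x i ^ m + t ^ m * x i ^ m" .
      have "form ?y \<le> form x * (\<Sum>j\<in>W. ?y j ^ m)"
      proof (rule opt)
        show "0 \<le> ?y j" if "j \<in> W" for j
          using x(1)[OF that] x(1)[OF i] \<open>0 < t\<close> by simp
        show "0 < (\<Sum>j\<in>W. ?y j ^ m)"
          using finite_W nonempty_W pos i \<open>0 < t\<close> by (intro sum_pos) auto
      qed
      then have "g t \<le> 0"
        unfolding norm g_def form_def[of ?y] prod_list_map_upd_scale by simp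
      also have "0 = g 1"
        by (simp add: g_def form_def)
      finally show ?thesis .
    qed
    have "(g has_real_derivative
        (\<Sum>is\<in>?A. T is * (real (count_list is i) * prod_list (map x is))) - form x * (m * x i ^ m)) (at 1)"
      unfolding g_def[abs_def] by (auto intro!: derivative_eq_intros simp: algebra_simps)
    \<comment> \<open>Radius 1 around \<open>t = 1\<close> keeps \<open>t\<close> positive. The
      vanishing derivative is the Lagrange condition times \<open>x i\<close>, with eigenvalue
      \<open>form x\<close>.\<close>
    then have "(\<Sum>is\<in>?A. T is * (real (count_list is i) * prod_list (map x is))) - form x * (m * x i ^ m) = 0"
      by (rule DERIV_local_max[of _ _ _ 1]) (auto intro!: g)
    then have "real m * (x i * tensor_apply W m T x i) = real m * (x i * (form x * x i ^ (m - 1)))"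
      unfolding sum_count_eq_tensor_apply[OF i] using m_pos by (simp add: power_eq_if)
    then show ?thesis
      using m_pos pos[OF i] by simp
  qed
  then show ?thesis
    unfolding is_HEC_def using pos by blast
qed

end


section \<open>The uplifted tensor\<close>

lemma uplift_edge_simps:
  assumes "size e \<le> m"
  shows "size (uplift_edge m e) = m"
    and "count (uplift_edge m e) None = m - size e"
    and "set_mset (uplift_edge m e) = Some ` set_mset e \<union> (if size e < m then {None} else {})"
  using assms by (auto simp: uplift_edge_def count_image_mset')

text \<open>A hyperedge of full size must get the value 1, as its factor \<open>k\<close> would be
  0; a shorter one receives at least one copy of \<open>None\<close>, which makes its weight
  positive.\<close>

lemma uplifted_tensor_pos:
  assumes "e \<in> E" "size e \<le> m" "mset is = uplift_edge m e"
  shows "0 < uplifted_tensor E m is"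
proof (cases "size e = m")
  case True
  then have "mset is = image_mset Some e"
    using assms by (simp add: uplift_edge_def)
  then show ?thesis
    using assms(1) by (simp add: uplifted_tensor_def)
next
  case False
  then show ?thesis
    using assms uplift_edge_simps(2)[OF assms(2)]
    by (auto simp: uplifted_tensor_def uplift_edges_def Let_def)
qed

lemma crossing_step:
  assumes "(u, v) \<in> r\<^sup>*" "u \<in> S" "v \<notin> S"
  obtains a b where "(a, b) \<in> r" "a \<in> S" "b \<notin> S"
  using assms by (induction rule: rtrancl_induct) blast+

text \<open>Either \<open>S\<close> separates two original nodes, and a path in the node graph
  crosses it, or \<open>S\<close> only separates \<open>None\<close> from \<open>V\<close>, and any
  uplifted short hyperedge crosses it.\<close>

lemma crossing_uplift_edge:
  assumes H: "hypergraph V E" "strongly_connected V E"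
    and size: "\<And>e. e \<in> E \<Longrightarrow> size e \<le> m"
    and S: "S \<subset> uplift_nodes V E m" "S \<noteq> {}"
  shows "\<exists>e\<in>E. \<exists>a b. a \<in># uplift_edge m e \<and> b \<in># uplift_edge m e \<and> a \<in> S \<and> b \<notin> S"
proof (cases "\<exists>u\<in>V. \<exists>v\<in>V. Some u \<in> S \<and> Some v \<notin> S")
  case True
  then obtain u v where uv: "u \<in> V" "v \<in> V" "Some u \<in> S" "Some v \<notin> S"
    by blast
  then have "(u, v) \<in> (node_adjacency E)\<^sup>*"
    using H(2) by (simp add: strongly_connected_def)
  then obtain a b where ab: "(a, b) \<in> node_adjacency E" "Some a \<in> S" "Some b \<notin> S"
    using crossing_step[of u v "node_adjacency E" "{w. Some w \<in> S}"] uv by auto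
  then obtain e where "e \<in> E" "a \<in># e" "b \<in># e"
    by (auto simp: node_adjacency_def)
  then show ?thesis
    using ab size[of e] by (intro bexI[of _ e] exI[of _ "Some a"] exI[of _ "Some b"])
      (auto simp: uplift_edge_simps(3))
next
  case False
  then have sides: "Some ` V \<subseteq> S \<or> Some ` V \<inter> S = {}"
    by auto
  \<comment> \<open>Otherwise only the original nodes remain, and \<open>S\<close> would contain all
    or none of them.\<close>
  have nonuniform: "\<not> (\<forall>e\<in>E. size e = m)"
    using sides S by (simp add: uplift_nodes_def split: if_splits) blast
  then have nodes: "uplift_nodes V E m = insert None (Some ` V)"
    by (auto simp: uplift_nodes_def)
  obtain e where e: "e \<in> E" "size e < m"
    using nonuniform size by (metis le_neq_implies_less)
  \<comment> \<open>Here hyperedges have to be nonempty: the padding \<open>None\<close> must share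
    its edge with an original node.\<close>
  then obtain v where v: "v \<in># e" "v \<in> V"
    using H(1) by (fastforce simp: hypergraph_def)
  have "{None, Some v} \<subseteq> set_mset (uplift_edge m e)"
    using e v by (auto simp: uplift_edge_simps(3))
  moreover have "(None \<in> S) \<noteq> (Some v \<in> S)"
    using sides S v(2) unfolding nodes by auto
  ultimately show ?thesis
    using e(1) by auto
qed

lemma uplifted_tensor_irreducible:
  assumes H: "hypergraph V E" "strongly_connected V E" and "E \<noteq> {}"
    and size: "\<And>e. e \<in> E \<Longrightarrow> size e \<le> m"
  shows "irreducible_tensor (uplift_nodes V E m) m (uplifted_tensor E m)"
proof
  show "finite (uplift_nodes V E m)" "uplift_nodes V E m \<noteq> {}"
    using H by (auto simp: uplift_nodes_def hypergraph_def strongly_connected_def)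
  obtain e where "e \<in> E"
    using \<open>E \<noteq> {}\<close> by blast
  then show "0 < m"
    using size[of e] H(1) by (auto simp: hypergraph_def intro!: Nat.gr0I)
  show "0 \<le> uplifted_tensor E m is" for "is"
    by (simp add: uplifted_tensor_def Let_def)
  show "uplifted_tensor E m is = uplifted_tensor E m js" if "mset is = mset js" for "is" js
    unfolding uplifted_tensor_def that ..
  fix S assume S: "S \<subset> uplift_nodes V E m" "S \<noteq> {}"
  obtain e a b where e: "e \<in> E" "a \<in># uplift_edge m e" "b \<in># uplift_edge m e" "a \<in> S" "b \<notin> S"
    using crossing_uplift_edge[OF H size S] by blast
  \<comment> \<open>One copy of \<open>a\<close> becomes the first index. As \<open>b\<close> lies
    on the other side of \<open>S\<close>, it differs from \<open>a\<close> and survives in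
    \<open>js\<close>.\<close>
  obtain js where js: "mset js = uplift_edge m e - {#a#}"
    using ex_mset by blast
  then have full: "mset (a # js) = uplift_edge m e"
    using e(2) by simp
  have "set_mset (uplift_edge m e) \<subseteq> uplift_nodes V E m"
    using H(1) e(1) size[OF e(1)]
    by (auto simp: uplift_edge_simps(3) uplift_nodes_def hypergraph_def)
  moreover have sets: "set (a # js) = set_mset (uplift_edge m e)"
    by (simp flip: full)
  moreover have "length (a # js) = m"
    using uplift_edge_simps(1)[OF size[OF e(1)]] by (metis full size_mset)
  moreover have "b \<in> set js"
    using sets e by auto
  moreover have "0 < uplifted_tensor E m (a # js)"
    by (rule uplifted_tensor_pos[OF e(1) size[OF e(1)] full])
  ultimately show "\<exists>i\<in>S. \<exists>js. set js \<subseteq> uplift_nodes V E m \<and> length js = m - 1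
      \<and> \<not> set js \<subseteq> S \<and> 0 < uplifted_tensor E m (i # js)"
    using e by (intro bexI[of _ a] exI[of _ js]) auto
qed

text \<open>A UHEC is the restriction of an HEC on the uplifted nodes, and restriction preserves
  proportionality. \<open>E \<noteq> {}\<close> makes \<open>M\<close> a genuine maximum and,
  hyperedges being nonempty, makes \<open>m\<close> positive.\<close>

theorem theorem4p2:
  fixes V :: "'a set" and E :: "'a multiset set" and M m :: nat
  assumes "hypergraph V E"
    and "strongly_connected V E"
    and "E \<noteq> {}"
    and "M = Max (size ` E)"
    and "m \<ge> M"
  shows "(\<exists>c. is_UHEC V E m c) \<and>
         (\<forall>c c'. is_UHEC V E m c \<longrightarrow> is_UHEC V E m c' \<longrightarrow>
            (\<exists>a>0. \<forall>v\<in>V. c' v = a * c v))"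
proof -
  have "size e \<le> m" if "e \<in> E" for e
    using assms that by (auto simp: hypergraph_def intro: order_trans[OF Max_ge])
  then interpret irreducible_tensor "uplift_nodes V E m" m "uplifted_tensor E m"
    using assms by (intro uplifted_tensor_irreducible)
  have nodes: "Some v \<in> uplift_nodes V E m" if "v \<in> V" for v
    using that by (simp add: uplift_nodes_def)
  show ?thesis
  proof (intro conjI allI impI)
    show "\<exists>c. is_UHEC V E m c"
      using HEC_exists by (auto simp: is_UHEC_def)
    fix c c' assume "is_UHEC V E m c" "is_UHEC V E m c'"
    then obtain d d' where
      "is_HEC (uplift_nodes V E m) m (uplifted_tensor E m) d" "\<And>v. v \<in> V \<Longrightarrow> c v = d (Some v)"
      "is_HEC (uplift_nodes V E m) m (uplifted_tensor E m) d'" "\<And>v. v \<in> V \<Longrightarrow> c' v = d' (Some v)"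
      unfolding is_UHEC_def by blast
    then show "\<exists>a>0. \<forall>v\<in>V. c' v = a * c v"
      using HEC_unique[of d d'] nodes by metis
  qed
qed

end
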